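(* Let $\mathbf{k}$ be an algebraically closed field of characteristic $0$. Let $\phi=(ax+P(y), by+c)\in \mathbb{J}_n$ be such that $\deg P(y)=n$. Assume $b\neq 1$ or $(b,c)=(1,0)$, and let $\tilde{x},\tilde{y},h_1$ be the polynomials associated with $\phi$ in the context. Then the following are true: (i) Suppose that $a$ and $b$ are roots of unity, and that $h_1 = 0$. Then $\phi$ is of finite order. (ii) Suppose that $a$ and $b$ are roots of unity, and that $h_1\neq 0$. Then $\mathrm{Supp}\,\mathfrak{I}_{\phi}= \mathbb{A}^2$, and $\mathfrak{I}_{\phi}$ is generated by some unions of the $y$-coordinate lines $y=y_0$ and the torsion points on the lines $h_1(y)=0$. A point of $\mathbb{A}^2$ is a torsion point of $\phi$ if and only if it lies on the lines $h_1(y)=0$. (iii) Suppose $a$ is not a root of unity, and $b$ is a root of unity. Then $\mathrm{Supp}\,\mathfrak{I}_{\phi}= \mathbb{A}^2$, and $\mathfrak{I}_{\phi}$ is generated by the curve $\tilde{x}=0$, some unions of $y$-coordinate lines $y=y_0$, and the torsion points on the curve $\tilde{x}=0$. A point of $\mathbb{A}^2$ is a torsion point of $\phi$ if and only if it lies on the curve $\tilde{x}=0$. (iv) Suppose $a$ is a root of unity and $b$ is not a root of unity. Then $\tilde{x}$ is $\phi$-equivariant, $\mathrm{Supp}\,\mathfrak{I}_{\phi}=\mathbb{A}^2$, and $\mathfrak{I}_{\phi}$ is generated by some unions of the fibers of $\tilde{x}$, the line $\tilde{y}=0$, and the torsion points on the line $\tilde{y}=0$. A point of $\mathbb{A}^2$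 is a torsion point of $\phi$ if and only if it lies on the line $\tilde{y}=0$.
   Context: $\mathbb{J}_n=\{(ax+P(y),by+c): a,b\in\mathbf{k}^\times,\ c\in\mathbf{k},\ P\in\mathbf{k}[y],\ \deg P\le n\}\subset\mathrm{Aut}(\mathbb{A}^2)$, acting on $\mathbb{A}^2=\mathrm{Spec}\,\mathbf{k}[x,y]$. Associated polynomials: put $\tilde{y}=y$ if $(b,c)=(1,0)$ and $\tilde{y}=y-\frac{c}{1-b}$ if $b\neq1$. Write $P(y)=\sum_{i=0}^n\tilde{a}_i\tilde{y}^i$. Then $$\tilde{x}=x-\sum_{0\le i\le n,\ a\neq b^i}\frac{\tilde{a}_i}{b^i-a}\tilde{y}^i,\qquad h_1(y)=\sum_{0\le i\le n,\ a=b^i}\tilde{a}_i\tilde{y}^i .$$ A variety is reduced but not necessarily irreducible, connected or pure dimensional; a curve is a 1-dimensional variety. Invariant subvariety lattice: $\mathfrak{I}_\phi$ is the set of all closed subvarieties of $\mathbb{A}^2$ invariant under $\langle\phi\rangle$ (including $\emptyset$ and $\mathbb{A}^2$). Its support $\mathrm{Supp}\,\mathfrak{I}_\phi$ is the union of all $Y\in\mathfrak{I}_\phi$ with $Y\neq \mathbb{A}^2$. A subset $\mathcal{I}\subset\mathfrak{I}_\phi$ generates $\mathfrak{I}_\phi$ if every element of $\mathfrak{I}_\phi$ except $\mathbb{A}^2$ is a union of elements of $\mathcal{I}$. "Generated by some unions of certain lines or fibers" means that the corresponding members of the generating subset are elements of $\mathfrak{I}_\phi$ that are unions of such lines or fibers.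 A torsion point of $\phi$ is a point with finite $\langle\phi\rangle$-orbit; when torsion points are listed among generators, the corresponding $0$-dimensional elements of $\mathfrak{I}_\phi$, i.e. their finite $\langle\phi\rangle$-orbits, are meant. A polynomial $\pi:\mathbb{A}^2\to\mathbb{A}^1$ is $\phi$-equivariant if there is $\overline\phi\in\mathrm{Aut}(\mathbb{A}^1)$ with $\pi\circ\phi=\overline\phi\circ\pi$.
   Formalization: In (iv), Supp = A^2 and "torsion iff on the line ỹ=0" are stated only under the extra assumption h_1 = 0; both fail otherwise, e.g. for φ=(x+1,2y), which has no torsion points and whose only proper invariant closed sets are ∅ and y=0. *)

theory Defs
  imports "HOL-Computational_Algebra.Computational_Algebra"
begin

text \<open>
  The ring \<open>k[x,y]\<close> is rendered as \<open>'k poly poly = k[y][x]\<close>: the outer variable is \<open>x\<close>, the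
  inner one is \<open>y\<close>. Thus \<open>x\<close> is \<open>[:0, 1:]\<close> and a polynomial \<open>q\<close> in \<open>y\<close> alone is \<open>[:q:]\<close>.
  Over an algebraically closed field, reduced closed subschemes of the affine plane are identified
  with their sets of closed points, that is, with Zariski closed subsets of \<open>'k \<times> 'k\<close>, and
  polynomial endomorphisms of the plane with the maps they induce on \<open>'k \<times> 'k\<close>.
\<close>

definition eval2 :: "'k::comm_ring_1 poly poly \<Rightarrow> 'k \<times> 'k \<Rightarrow> 'k" where
  "eval2 f p = poly (poly f [:fst p:]) (snd p)"

definition zero_locus :: "'k::comm_ring_1 poly poly set \<Rightarrow> ('k \<times> 'k) set" where
  "zero_locus S = {p. \<forall>f\<in>S. eval2 f p = 0}"

definition closed_subvariety :: "('k::comm_ring_1 \<times> 'k) set \<Rightarrow> bool" where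
  "closed_subvariety Y \<longleftrightarrow> (\<exists>S. Y = zero_locus S)"

definition poly_map :: "'k::comm_ring_1 poly poly \<Rightarrow> 'k poly poly \<Rightarrow> 'k \<times> 'k \<Rightarrow> 'k \<times> 'k" where
  "poly_map f g p = (eval2 f p, eval2 g p)"

definition Aut_A2 :: "('k::comm_ring_1 \<times> 'k \<Rightarrow> 'k \<times> 'k) set" where
  "Aut_A2 = {\<phi>. \<exists>f g f' g'. \<phi> = poly_map f g \<and>
      poly_map f g \<circ> poly_map f' g' = id \<and> poly_map f' g' \<circ> poly_map f g = id}"

definition Aut_A1 :: "('k::comm_ring_1 \<Rightarrow> 'k) set" where
  "Aut_A1 = {\<psi>. \<exists>f g. \<psi> = poly f \<and> poly f \<circ> poly g = id \<and> poly g \<circ> poly f = id}"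

text \<open>The map \<open>(a x + P(y), b y + c)\<close>.\<close>

definition jonq :: "'k::comm_ring_1 \<Rightarrow> 'k \<Rightarrow> 'k \<Rightarrow> 'k poly \<Rightarrow> 'k \<times> 'k \<Rightarrow> 'k \<times> 'k" where
  "jonq a b c P = poly_map [:P, [:a:]:] [:[:c, b:]:]"

definition J :: "nat \<Rightarrow> ('k::comm_ring_1 \<times> 'k \<Rightarrow> 'k \<times> 'k) set" where
  "J n = {jonq a b c P | a b c P. a \<noteq> 0 \<and> b \<noteq> 0 \<and> degree P \<le> n}"

definition cyclic_group :: "('a \<Rightarrow> 'a) \<Rightarrow> ('a \<Rightarrow> 'a) set" where
  "cyclic_group \<phi> = {\<phi> ^^ m | m. True} \<union> {(inv \<phi>) ^^ m | m. True}"

definition finite_order :: "('a \<Rightarrow> 'a) \<Rightarrow> bool" where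
  "finite_order \<phi> \<longleftrightarrow> (\<exists>m>0. \<phi> ^^ m = id)"

definition orbit :: "('a \<Rightarrow> 'a) \<Rightarrow> 'a \<Rightarrow> 'a set" where
  "orbit \<phi> p = {g p | g. g \<in> cyclic_group \<phi>}"

definition torsion_point :: "('a \<Rightarrow> 'a) \<Rightarrow> 'a \<Rightarrow> bool" where
  "torsion_point \<phi> p \<longleftrightarrow> finite (orbit \<phi> p)"

definition torsion_orbits_on :: "('a \<Rightarrow> 'a) \<Rightarrow> 'a set \<Rightarrow> 'a set set" where
  "torsion_orbits_on \<phi> Z = {orbit \<phi> p | p. torsion_point \<phi> p \<and> p \<in> Z}"

definition inv_lattice :: "('k::comm_ring_1 \<times> 'k \<Rightarrow> 'k \<times> 'k) \<Rightarrow> ('k \<times> 'k) set set" where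
  "inv_lattice \<phi> = {Y. closed_subvariety Y \<and> (\<forall>g\<in>cyclic_group \<phi>. g ` Y = Y)}"

definition Supp :: "('k::comm_ring_1 \<times> 'k \<Rightarrow> 'k \<times> 'k) \<Rightarrow> ('k \<times> 'k) set" where
  "Supp \<phi> = \<Union>{Y \<in> inv_lattice \<phi>. Y \<noteq> UNIV}"

text \<open>
  The unions are finite, as these are the unions that exist in a lattice of closed
  subvarieties; the empty union gives \<open>{}\<close>. With infinite unions allowed, a curve all of whose
  points are torsion would be a redundant generator.
\<close>

definition generates_lattice ::
    "('k::comm_ring_1 \<times> 'k \<Rightarrow> 'k \<times> 'k) \<Rightarrow> ('k \<times> 'k) set set \<Rightarrow> bool" where
  "generates_lattice \<phi> I \<longleftrightarrow> I \<subseteq> inv_lattice \<phi> \<and>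
     (\<forall>Y\<in>inv_lattice \<phi>. Y \<noteq> UNIV \<longrightarrow> (\<exists>C\<subseteq>I. finite C \<and> Y = \<Union>C))"

definition unions_of :: "'a set set \<Rightarrow> 'a set set" where
  "unions_of F = {\<Union>C | C. C \<subseteq> F}"

definition y_lines :: "('k::comm_ring_1 \<times> 'k) set set" where
  "y_lines = {zero_locus {[:[:- y0, 1:]:]} | y0. True}"

definition fibers :: "'k::comm_ring_1 poly poly \<Rightarrow> ('k \<times> 'k) set set" where
  "fibers \<pi> = {{p. eval2 \<pi> p = t} | t. True}"

definition equivariant ::
    "('k::comm_ring_1 \<times> 'k \<Rightarrow> 'k \<times> 'k) \<Rightarrow> 'k poly poly \<Rightarrow> bool" where
  "equivariant \<phi> \<pi> \<longleftrightarrow> (\<exists>\<psi>\<in>Aut_A1. eval2 \<pi> \<circ> \<phi> = \<psi> \<circ> eval2 \<pi>)"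

definition root_of_unity :: "'k::comm_ring_1 \<Rightarrow> bool" where
  "root_of_unity a \<longleftrightarrow> (\<exists>m>0. a ^ m = 1)"

text \<open>
  Only meaningful if \<open>b \<noteq> 1\<close> or \<open>(b, c) = (1, 0)\<close>. In \<open>xtilde\<close> and \<open>h1\<close>, the family \<open>\<alpha>\<close>
  consists of the coefficients of \<open>P\<close> with respect to the powers of \<open>ytilde b c\<close>.
\<close>

definition ytilde :: "'k::field \<Rightarrow> 'k \<Rightarrow> 'k poly" where
  "ytilde b c = (if b = 1 then [:0, 1:] else [:- (c / (1 - b)), 1:])"

definition xtilde :: "'k::field \<Rightarrow> 'k \<Rightarrow> 'k \<Rightarrow> nat \<Rightarrow> (nat \<Rightarrow> 'k) \<Rightarrow> 'k poly poly" where
  "xtilde a b c n \<alpha> =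
     [:0, 1:] - [:(\<Sum>i | i \<le> n \<and> a \<noteq> b ^ i. smult (\<alpha> i / (b ^ i - a)) (ytilde b c ^ i)):]"

definition h1 :: "'k::field \<Rightarrow> 'k \<Rightarrow> 'k \<Rightarrow> nat \<Rightarrow> (nat \<Rightarrow> 'k) \<Rightarrow> 'k poly" where
  "h1 a b c n \<alpha> = (\<Sum>i | i \<le> n \<and> a = b ^ i. smult (\<alpha> i) (ytilde b c ^ i))"

lemma eval2_simps [simp]:
  "eval2 [:q:] p = poly q (snd p)"
  "eval2 [:q, r:] p = poly q (snd p) + fst p * poly r (snd p)"
  by (simp_all add: eval2_def)

lemma jonq_apply: "jonq a b c P (u, v) = (a * u + poly P v, b * v + c)"
  by (simp add: jonq_def poly_map_def algebra_simps)

lemma jonq_in_J_iff: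
  fixes a b c :: "'k::field_char_0"
  shows "jonq a b c P \<in> J n \<longleftrightarrow> a \<noteq> 0 \<and> b \<noteq> 0 \<and> degree P \<le> n"
proof
  assume "jonq a b c P \<in> J n"
  then obtain a' b' c' P' where eq: "jonq a b c P = jonq a' b' c' P'"
    and nz: "a' \<noteq> 0" "b' \<noteq> 0" "degree P' \<le> n"
    by (auto simp: J_def)
  have *: "a * u + poly P v = a' * u + poly P' v" "b * v + c = b' * v + c'" for u v
    using fun_cong[OF eq, of "(u, v)"] by (simp_all add: jonq_apply)
  have "poly P = poly P'" using *(1)[of 0] by auto
  hence "P = P'" by (simp add: poly_eq_poly_eq_iff)
  moreover have "a = a'" using *(1)[of 1 0] \<open>P = P'\<close> by simp
  moreover have "b = b'" using *(2)[of 0] *(2)[of 1] by simp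
  ultimately show "a \<noteq> 0 \<and> b \<noteq> 0 \<and> degree P \<le> n" using nz by simp
qed (auto simp: J_def)

lemma J_subset_Aut_A2: "J n \<subseteq> (Aut_A2 :: ('k::field \<times> 'k \<Rightarrow> _) set)"
proof
  fix \<phi> :: "'k \<times> 'k \<Rightarrow> 'k \<times> 'k" assume "\<phi> \<in> J n"
  then obtain a b c P where \<phi>: "\<phi> = jonq a b c P" and nz: "a \<noteq> 0" "b \<noteq> 0"
    by (auto simp: J_def)
  define Q where "Q = smult (- (1 / a)) (pcompose P [:- (c / b), 1 / b:])"
  have "jonq a b c P \<circ> jonq (1 / a) (1 / b) (- (c / b)) Q = id"
    "jonq (1 / a) (1 / b) (- (c / b)) Q \<circ> jonq a b c P = id"
    using nz by (auto simp: fun_eq_iff jonq_apply Q_def poly_pcompose field_simps)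
  thus "\<phi> \<in> Aut_A2" unfolding Aut_A2_def \<phi> jonq_def by blast
qed

lemma ytilde_expansion_ex1:
  fixes P :: "'k::field poly"
  assumes "degree P \<le> n"
  shows "\<exists>!\<alpha>. (\<forall>i>n. \<alpha> i = 0) \<and> P = (\<Sum>i\<le>n. smult (\<alpha> i) (ytilde b c ^ i))"
proof -
  define d where "d = (if b = 1 then 0 else c / (1 - b))"
  have y: "ytilde b c = [:- d, 1:]" by (simp add: ytilde_def d_def)
  have iv: "pcompose [:- d, 1:] [:d, 1:] = [:0, 1:]" "pcompose [:d, 1:] [:- d, 1:] = [:0, 1:]"
    by (simp_all add: pcompose_pCons)
  have pw: "pcompose (p ^ i) q = pcompose p q ^ i" for p q :: "'k poly" and i
    by (induction i) (simp_all add: pcompose_mult pcompose_1)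
  have sh: "pcompose (\<Sum>i\<le>n. smult (\<alpha> i) ([:- d, 1:] ^ i)) [:d, 1:] = (\<Sum>i\<le>n. monom (\<alpha> i) i)" for \<alpha>
    by (simp only: pcompose_sum pcompose_smult pw iv monom_altdef)
  have inj: "p = q" if "pcompose p [:d, 1:] = pcompose q [:d, 1:]" for p q :: "'k poly"
    using arg_cong[OF that, of "\<lambda>r. pcompose r [:- d, 1:]"]
    unfolding pcompose_assoc[symmetric] iv by (simp add: pcompose_idR)
  have cf: "coeff (\<Sum>i\<le>n. monom (\<alpha> i) i) j = (if j \<le> n then \<alpha> j else 0)" for j and \<alpha> :: "nat \<Rightarrow> 'k"
    by (simp add: coeff_sum)
  define R where "R = pcompose P [:d, 1:]"
  have R: "degree R \<le> n" using assms by (simp add: R_def degree_pcompose)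
  show ?thesis unfolding y
  proof (rule ex1I[of _ "coeff R"])
    have "pcompose P [:d, 1:] = pcompose (\<Sum>i\<le>n. smult (coeff R i) ([:- d, 1:] ^ i)) [:d, 1:]"
      unfolding sh R_def[symmetric] poly_as_sum_of_monoms'[OF R] ..
    thus "(\<forall>i>n. coeff R i = 0) \<and> P = (\<Sum>i\<le>n. smult (coeff R i) ([:- d, 1:] ^ i))"
      using R inj by (metis coeff_eq_0 order.strict_trans1)
  next
    fix \<alpha> assume a: "(\<forall>i>n. \<alpha> i = 0) \<and> P = (\<Sum>i\<le>n. smult (\<alpha> i) ([:- d, 1:] ^ i))"
    hence "R = (\<Sum>i\<le>n. monom (\<alpha> i) i)" unfolding R_def using sh[of \<alpha>] by simp
    hence "coeff R j = (if j \<le> n then \<alpha> j else 0)" for j using cf by metis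
    moreover have "\<alpha> j = 0" if "\<not> j \<le> n" for j using a that by simp
    ultimately show "\<alpha> = coeff R" by (intro ext) simp
  qed
qed

end

theory Submission
  imports Defs
begin

text \<open>
  In the coordinates \<open>X = xtilde\<close>, \<open>Y = ytilde\<close> the map is \<open>(a X + H, b Y)\<close>, where \<open>H = h1\<close> is a
  combination of those powers \<open>Y\<^sup>i\<close> with \<open>b\<^sup>i = a\<close> (\<open>straightened_jonquieres_jonq\<close>). Since \<open>H\<close>
  is multiplied by \<open>a\<close> under \<open>\<phi>\<close>, the iterates are \<open>\<phi>\<^sup>m = (a\<^sup>m X + m a\<^sup>m\<^sup>-\<^sup>1 H, b\<^sup>m Y)\<close>. From this
  formula one reads off when \<open>\<phi>\<close> has finite order and which points are torsion.

  If \<open>b\<close> is a root of unity, some iterate \<open>\<phi>\<^sup>N\<close> preserves every line \<open>y = y\<^sub>0\<close>; if \<open>a\<close> is one and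
  \<open>H = 0\<close>, some iterate preserves every fibre of \<open>X\<close>. In both situations the plane is fibred by
  rational curves, each carried to itself by \<open>\<phi>\<^sup>N\<close>, and the locale \<open>periodic_fibration\<close> gives the
  shape of an invariant closed set \<open>Z\<close>. A non-torsion point of \<open>Z\<close> has infinitely many translates
  on its fibre, so \<open>Z\<close> contains the whole fibre (\<open>fiber_subset_if_not_torsion\<close>). A proper \<open>Z\<close>
  contains finitely many fibres, and outside them it consists of torsion points. The torsion locus is
  a finite union of lines \<open>H = 0\<close>, the curve \<open>X = 0\<close>, or the line \<open>Y = 0\<close>; a closed set meets a
  polynomially parametrised curve in finitely many points unless it contains that curve
  (\<open>parametrised_curve_subset_closed\<close>). So the rest of \<open>Z\<close> is finite, hence a finite
  union of finite orbits, or it is the curve up to the fibres already counted.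
  The support is the whole plane because the images of one fibre form a proper invariant closed set.

  In the remaining situation \<open>b\<close> is not a root of unity, \<open>a\<close> is one, and \<open>H \<noteq> 0\<close>. Then \<open>a = 1\<close> and \<open>H\<close> is a
  constant \<open>e\<close>, so \<open>\<phi>\<^sup>m = (X + m e, b\<^sup>m Y)\<close>. Independence of exponential polynomials shows that
  points with \<open>Y \<noteq> 0\<close> have dense orbits (\<open>dense_orbit\<close>), so a proper invariant set lies in \<open>Y = 0\<close>.
  There \<open>\<phi>\<close> is a translation of infinite order, and only the empty set and the line are left.
\<close>

section \<open>Cyclic groups, orbits and torsion points\<close>

lemma image_eq_selfI:
  assumes "bij f" "\<And>x. x \<in> A \<Longrightarrow> f x \<in> A" "\<And>x. x \<in> A \<Longrightarrow> inv f x \<in> A"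
  shows "f ` A = A"
proof
  show "f ` A \<subseteq> A" using assms(2) by blast
  show "A \<subseteq> f ` A"
  proof
    fix x assume "x \<in> A"
    then have "inv f x \<in> A" by (rule assms(3))
    moreover have "x = f (inv f x)" using assms(1) by (simp add: bij_is_surj surj_f_inv_f)
    ultimately show "x \<in> f ` A" by blast
  qed
qed

lemma cyclic_group_image_eq:
  assumes f: "bij f" and A: "f ` A = A" and g: "g \<in> cyclic_group f"
  shows "g ` A = A"
proof -
  have inv_A: "inv f ` A = A"
    using image_inv_f_f[OF bij_is_inj[OF f], of A] A by simp
  have "(f ^^ m) ` A = A" for m
    by (induction m) (simp_all only: funpow.simps image_comp[symmetric] A image_id id_apply image_ident)
  moreover have "(inv f ^^ m) ` A = A" for m
    by (induction m) (simp_all only: funpow.simps image_comp[symmetric] inv_A image_id id_apply image_ident)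
  ultimately show ?thesis using g unfolding cyclic_group_def by blast
qed

lemma funpow_in_orbit: "(f ^^ m) p \<in> orbit f p"
  unfolding orbit_def cyclic_group_def by blast

lemma self_in_orbit: "p \<in> orbit f p"
  using funpow_in_orbit[of 0 f p] by simp

lemma orbit_subset:
  assumes "bij f" "f ` A = A" "p \<in> A"
  shows "orbit f p \<subseteq> A"
  unfolding orbit_def using cyclic_group_image_eq[OF assms(1,2)] assms(3) by blast

lemma image_orbit:
  assumes f: "bij f"
  shows "f ` orbit f p = orbit f p"
proof (rule image_eq_selfI[OF f])
  have fi: "f (inv f x) = x" and if': "inv f (f x) = x" for x
    using f by (simp_all add: bij_is_surj surj_f_inv_f bij_is_inj)
  have neg: "(inv f ^^ m) p \<in> orbit f p" for m
    unfolding orbit_def cyclic_group_def by blast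
  fix x assume "x \<in> orbit f p"
  then consider m where "x = (f ^^ m) p" | m where "x = (inv f ^^ m) p"
    unfolding orbit_def cyclic_group_def by blast
  note cases = this
  show "f x \<in> orbit f p"
  proof (cases rule: cases)
    case (1 m)
    then show ?thesis using funpow_in_orbit[of "Suc m" f p] by simp
  next
    case (2 m)
    then show ?thesis
      using funpow_in_orbit[of 1 f p] neg by (cases m) (auto simp: fi)
  qed
  show "inv f x \<in> orbit f p"
  proof (cases rule: cases)
    case (1 m)
    then show ?thesis
      using neg[of 1] funpow_in_orbit[of _ f p] by (cases m) (auto simp: if')
  next
    case (2 m)
    then show ?thesis using neg[of "Suc m"] by simp
  qed
qed

lemma torsion_point_iff_periodic:
  assumes f: "bij f"
  shows "torsion_point f p \<longleftrightarrow> (\<exists>m>0. (f ^^ m) p = p)"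
proof
  assume "torsion_point f p"
  then have "finite (range (\<lambda>m. (f ^^ m) p))"
    unfolding torsion_point_def
    by (rule finite_subset[rotated]) (auto simp: funpow_in_orbit)
  then have "\<not> inj (\<lambda>m. (f ^^ m) p)"
    using finite_imageD infinite_UNIV_nat by blast
  then obtain i j where "i < j" and eq: "(f ^^ i) p = (f ^^ j) p"
    by (auto simp: inj_on_def) (metis linorder_neqE_nat)
  moreover from this have "(f ^^ j) p = (f ^^ i) ((f ^^ (j - i)) p)"
    by (metis add_diff_inverse_nat comp_apply funpow_add order_less_imp_not_less)
  ultimately have "(f ^^ (j - i)) p = p"
    using inj_fn[OF bij_is_inj[OF f], of i] by (simp add: inj_eq)
  with \<open>i < j\<close> show "\<exists>m>0. (f ^^ m) p = p" by (intro exI[of _ "j - i"]) simp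
next
  assume "\<exists>m>0. (f ^^ m) p = p"
  then obtain m where m: "m > 0" "(f ^^ m) p = p" by blast
  define A where "A = (\<lambda>i. (f ^^ i) p) ` {..<m}"
  have "f x \<in> A" if "x \<in> A" for x
  proof -
    from that obtain i where i: "i < m" "x = (f ^^ i) p" by (auto simp: A_def)
    show ?thesis
    proof (cases "Suc i = m")
      case True
      then have "f x = (f ^^ 0) p" using i m by auto
      then show ?thesis using m unfolding A_def by blast
    next
      case False
      then have "Suc i < m" "f x = (f ^^ Suc i) p" using i by auto
      then show ?thesis unfolding A_def by blast
    qed
  qed
  then have "f ` A = A"
    by (intro card_subset_eq) (auto simp: A_def card_image inj_on_subset[OF bij_is_inj[OF f]])
  moreover have "p \<in> A" unfolding A_def using m by (intro image_eqI[of _ _ 0]) auto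
  ultimately have "orbit f p \<subseteq> A" using orbit_subset[OF f] by blast
  then show "torsion_point f p"
    unfolding torsion_point_def A_def by (rule finite_subset) simp
qed

lemma funpow_periodic:
  assumes "(f ^^ m) p = p"
  shows "(f ^^ (k * m)) p = p"
  by (induction k) (simp_all add: funpow_add assms)

section \<open>Closed subvarieties of the plane\<close>

lemma eval2_add: "eval2 (f + g) p = eval2 f p + eval2 g p"
  and eval2_mult: "eval2 (f * g) p = eval2 f p * eval2 g p"
  and eval2_0: "eval2 0 p = 0"
  and eval2_1: "eval2 1 p = 1"
  by (simp_all add: eval2_def)

lemma eval2_diff: "eval2 (f - g) (p :: 'k::comm_ring_1 \<times> 'k) = eval2 f p - eval2 g p"
  by (simp add: eval2_def)

lemma eval2_pCons: "eval2 (pCons q f) p = poly q (snd p) + fst p * eval2 f p"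
  by (simp add: eval2_def)

lemma closed_subvariety_empty: "closed_subvariety ({} :: ('k::comm_ring_1 \<times> 'k) set)"
  unfolding closed_subvariety_def zero_locus_def
  by (intro exI[of _ "{1}"]) (simp add: eval2_1)

lemma closed_subvariety_Un:
  fixes Y Z :: "('k::idom \<times> 'k) set"
  assumes "closed_subvariety Y" "closed_subvariety Z"
  shows "closed_subvariety (Y \<union> Z)"
proof -
  from assms obtain S T where ST: "Y = zero_locus S" "Z = zero_locus T"
    by (auto simp: closed_subvariety_def)
  have "p \<in> Y \<union> Z \<longleftrightarrow> (\<forall>f\<in>S. \<forall>g\<in>T. eval2 (f * g) p = 0)" for p
    unfolding ST zero_locus_def eval2_mult mult_eq_0_iff by blast
  then have "Y \<union> Z = zero_locus {f * g | f g. f \<in> S \<and> g \<in> T}"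
    unfolding zero_locus_def by blast
  then show ?thesis unfolding closed_subvariety_def by blast
qed

lemma closed_subvariety_Union:
  fixes C :: "('k::idom \<times> 'k) set set"
  assumes "finite C" "\<And>Y. Y \<in> C \<Longrightarrow> closed_subvariety Y"
  shows "closed_subvariety (\<Union>C)"
  using assms
  by (induction C) (simp_all add: closed_subvariety_empty closed_subvariety_Un)

lemma closed_subvariety_zero_locus: "closed_subvariety (zero_locus S)"
  unfolding closed_subvariety_def by blast

lemma closed_subvariety_fiber:
  "closed_subvariety {p :: 'k::comm_ring_1 \<times> 'k. eval2 \<pi> p = t}"
proof -
  have "{p. eval2 \<pi> p = t} = zero_locus {\<pi> - [:[:t:]:]}"
    by (simp add: zero_locus_def eval2_diff)
  then show ?thesis by (simp add: closed_subvariety_zero_locus)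
qed

lemma closed_subvariety_finite:
  fixes A :: "('k::idom \<times> 'k) set"
  assumes "finite A"
  shows "closed_subvariety A"
proof -
  have "{p} = zero_locus {[:[:- fst p:], 1:], [:[:- snd p, 1:]:]}" for p :: "'k \<times> 'k"
    by (auto simp: zero_locus_def prod_eq_iff)
  then have "closed_subvariety {p}" for p :: "'k \<times> 'k"
    by (metis closed_subvariety_zero_locus)
  moreover have "A = \<Union>((\<lambda>p. {p}) ` A)" by simp
  ultimately show ?thesis
    using closed_subvariety_Union[of "(\<lambda>p. {p}) ` A"] assms by fastforce
qed

text \<open>
  A single nonzero equation is all that the finiteness arguments below need of a proper closed set.
\<close>

lemma proper_closed_subvariety_equation:
  fixes Z :: "('k::comm_ring_1 \<times> 'k) set"
  assumes "closed_subvariety Z" "Z \<noteq> UNIV"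
  obtains f where "f \<noteq> 0" "\<And>p. p \<in> Z \<Longrightarrow> eval2 f p = 0"
proof -
  from assms obtain S where S: "Z = zero_locus S" by (auto simp: closed_subvariety_def)
  with assms(2) obtain f where "f \<in> S" "f \<noteq> 0"
    by (auto simp: zero_locus_def) (metis eval2_0)
  with S show thesis by (intro that[of f]) (auto simp: zero_locus_def)
qed

text \<open>
  Polynomial functions of the plane are closed under substitution of polynomial functions. This
  restricts equations to parametrised curves and to parametrised families of orbits.
\<close>

lemma eval2_compose_ex:
  fixes f u v :: "'k::comm_ring_1 poly poly"
  shows "\<exists>g. \<forall>p. eval2 f (eval2 u p, eval2 v p) = eval2 g p"
proof (induction f)
  case 0
  show ?case by (intro exI[of _ 0]) (simp add: eval2_0)
next
  case (pCons q f)
  have "\<exists>g. \<forall>p. poly r (eval2 v p) = eval2 g p" for r :: "'k poly"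
  proof (induction r)
    case 0
    show ?case by (intro exI[of _ 0]) (simp add: eval2_0)
  next
    case (pCons c r)
    then obtain g where "\<And>p. poly r (eval2 v p) = eval2 g p" by blast
    then show ?case
      by (intro exI[of _ "[:[:c:]:] + v * g"]) (simp add: eval2_add eval2_mult)
  qed
  then obtain g where "\<And>p. poly q (eval2 v p) = eval2 g p" by blast
  moreover from pCons.IH obtain g' where "\<And>p. eval2 f (eval2 u p, eval2 v p) = eval2 g' p"
    by blast
  ultimately show ?case
    by (intro exI[of _ "g + u * g'"]) (simp add: eval2_pCons eval2_add eval2_mult)
qed

text \<open>
  Restricting an equation of \<open>Z\<close> to a polynomially parametrised curve gives a polynomial in the
  parameter, which has infinitely many roots only if it is zero.
\<close>

lemma parametrised_curve_subset_closed:
  fixes Z :: "('k::idom \<times> 'k) set"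
  assumes "closed_subvariety Z"
    and inf: "infinite (Z \<inter> range (\<lambda>t. (poly u t, poly v t)))"
  shows "range (\<lambda>t. (poly u t, poly v t)) \<subseteq> Z"
proof -
  define \<gamma> where "\<gamma> = (\<lambda>t. (poly u t, poly v t))"
  from assms(1) obtain S where S: "Z = zero_locus S" by (auto simp: closed_subvariety_def)
  have "Z \<inter> range \<gamma> = \<gamma> ` {t. \<gamma> t \<in> Z}" by auto
  with inf have inf': "infinite {t. \<gamma> t \<in> Z}" unfolding \<gamma>_def[symmetric] by auto
  have "eval2 f (\<gamma> t) = 0" if "f \<in> S" for f t
  proof -
    obtain g where g: "\<And>p. eval2 f (eval2 [:u:] p, eval2 [:v:] p) = eval2 g p"
      using eval2_compose_ex by blast
    have g': "eval2 f (\<gamma> s) = poly (poly g 0) s" for s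
      using g[of "(0, s)"] by (simp add: \<gamma>_def eval2_def)
    have "{s. \<gamma> s \<in> Z} \<subseteq> {s. poly (poly g 0) s = 0}"
      using S that g' by (auto simp: zero_locus_def)
    with inf' have "poly g 0 = 0" using poly_roots_finite finite_subset by blast
    then show ?thesis by (simp add: g')
  qed
  then show ?thesis unfolding \<gamma>_def[symmetric] S zero_locus_def by blast
qed

lemma inv_lattice_iff:
  assumes "bij \<phi>"
  shows "Y \<in> inv_lattice \<phi> \<longleftrightarrow> closed_subvariety Y \<and> \<phi> ` Y = Y"
proof -
  have "\<phi> \<in> cyclic_group \<phi>"
    unfolding cyclic_group_def by (auto intro: exI[of _ 1])
  then show ?thesis
    unfolding inv_lattice_def using cyclic_group_image_eq[OF assms] by blast
qed

section \<open>Fibrations whose fibres are periodic\<close>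

lemma torsion_orbit_in_inv_lattice:
  fixes \<phi> :: "'k::idom \<times> 'k \<Rightarrow> 'k \<times> 'k"
  assumes "bij \<phi>" "torsion_point \<phi> p"
  shows "orbit \<phi> p \<in> inv_lattice \<phi>"
  using assms closed_subvariety_finite
  by (simp add: inv_lattice_iff torsion_point_def image_orbit)

lemma orbit_subset_inv_lattice:
  assumes "bij \<phi>" "Z \<in> inv_lattice \<phi>" "p \<in> Z"
  shows "orbit \<phi> p \<subseteq> Z"
  using assms(2,3) orbit_subset[OF assms(1)] unfolding inv_lattice_iff[OF assms(1)] by blast

text \<open>
  An invariant \<open>Z\<close> is a finite union of generators as soon as one invariant union \<open>W\<close> of members of
  \<open>F\<close> can be split off whose complement in \<open>Z\<close> is a finite set of torsion points, hence
  lies in finitely many finite orbits, or is covered by a single extra generator inside \<open>Z\<close>.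
\<close>

lemma generates_latticeI:
  fixes \<phi> :: "'k::idom \<times> 'k \<Rightarrow> 'k \<times> 'k"
  assumes bij: "bij \<phi>"
    and E: "E \<subseteq> inv_lattice \<phi>"
    and split: "\<And>Z. Z \<in> inv_lattice \<phi> \<Longrightarrow> Z \<noteq> UNIV \<Longrightarrow>
      \<exists>W \<in> unions_of F \<inter> inv_lattice \<phi>. W \<subseteq> Z \<and>
        (finite (Z - W) \<and> (\<forall>p\<in>Z - W. torsion_point \<phi> p \<and> p \<in> T) \<or>
         (\<exists>K\<in>E. Z - W \<subseteq> K \<and> K \<subseteq> Z))"
  shows "generates_lattice \<phi> (unions_of F \<inter> inv_lattice \<phi> \<union> E \<union> torsion_orbits_on \<phi> T)"
  unfolding generates_lattice_def
proof (intro conjI ballI impI)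
  show "unions_of F \<inter> inv_lattice \<phi> \<union> E \<union> torsion_orbits_on \<phi> T \<subseteq> inv_lattice \<phi>"
    using E torsion_orbit_in_inv_lattice[OF bij] by (auto simp: torsion_orbits_on_def)
next
  fix Z assume Z: "Z \<in> inv_lattice \<phi>" "Z \<noteq> UNIV"
  let ?G = "unions_of F \<inter> inv_lattice \<phi> \<union> E \<union> torsion_orbits_on \<phi> T"
  from split[OF Z] obtain W where W: "W \<in> unions_of F \<inter> inv_lattice \<phi>" "W \<subseteq> Z"
    and rest: "finite (Z - W) \<and> (\<forall>p\<in>Z - W. torsion_point \<phi> p \<and> p \<in> T) \<or>
         (\<exists>K\<in>E. Z - W \<subseteq> K \<and> K \<subseteq> Z)" by blast
  from rest show "\<exists>C\<subseteq>?G. finite C \<and> Z = \<Union>C"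
  proof
    assume fin: "finite (Z - W) \<and> (\<forall>p\<in>Z - W. torsion_point \<phi> p \<and> p \<in> T)"
    have "orbit \<phi> p \<subseteq> Z" if "p \<in> Z" for p
      using orbit_subset_inv_lattice[OF bij Z(1) that] .
    then have "Z = \<Union>(insert W (orbit \<phi> ` (Z - W)))"
      using W(2) self_in_orbit by fastforce
    moreover have "insert W (orbit \<phi> ` (Z - W)) \<subseteq> ?G"
      using W(1) fin by (auto simp: torsion_orbits_on_def)
    ultimately show ?thesis using fin by (intro exI[of _ "insert W (orbit \<phi> ` (Z - W))"]) simp
  next
    assume "\<exists>K\<in>E. Z - W \<subseteq> K \<and> K \<subseteq> Z"
    then obtain K where "K \<in> E" "Z - W \<subseteq> K" "K \<subseteq> Z" by blast
    then show ?thesis using W by (intro exI[of _ "{W, K}"]) auto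
  qed
qed

text \<open>
  The common abstraction of the lines \<open>y = y\<^sub>0\<close>, for \<open>b\<close> a root of unity, and of the fibres of
  \<open>xtilde\<close>, for \<open>a\<close> a root of unity and \<open>h1 = 0\<close>.
\<close>

locale periodic_fibration =
  fixes \<phi> :: "'k::field_char_0 \<times> 'k \<Rightarrow> 'k \<times> 'k" and \<pi> :: "'k poly poly" and N :: nat
  assumes bij: "bij \<phi>"
    and fiber_iff: "eval2 \<pi> (\<phi> p) = eval2 \<pi> (\<phi> r) \<longleftrightarrow> eval2 \<pi> p = eval2 \<pi> r"
    and period_pos: "N > 0"
    and period: "eval2 \<pi> ((\<phi> ^^ N) p) = eval2 \<pi> p"
    and fiber_param: "\<exists>u v. {p. eval2 \<pi> p = t} = range (\<lambda>s. (poly u s, poly v s))"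
    and finite_fibers_in_curve:
      "f \<noteq> 0 \<Longrightarrow> finite {t. \<forall>p. eval2 \<pi> p = t \<longrightarrow> eval2 f p = 0}"
begin

lemma fiber_nonempty: "\<exists>p. eval2 \<pi> p = t"
  using fiber_param[of t] by blast

lemma finite_fibers_in_closed:
  assumes "closed_subvariety Z" "Z \<noteq> UNIV"
  shows "finite {t. {p. eval2 \<pi> p = t} \<subseteq> Z}"
proof -
  from proper_closed_subvariety_equation[OF assms] obtain f
    where f: "f \<noteq> 0" "\<And>p. p \<in> Z \<Longrightarrow> eval2 f p = 0" by blast
  show ?thesis
    by (rule finite_subset[OF _ finite_fibers_in_curve[OF f(1)]]) (use f(2) in auto)
qed

text \<open>
  The points \<open>\<phi>\<^sup>N\<^sup>k p\<close> all lie on the fibre through \<open>p\<close>; there are infinitely many of them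
  when \<open>p\<close> is not torsion, so a closed set containing them contains the fibre.
\<close>

lemma fiber_subset_if_not_torsion:
  assumes Z: "Z \<in> inv_lattice \<phi>" and p: "p \<in> Z" "\<not> torsion_point \<phi> p"
  shows "{r. eval2 \<pi> r = eval2 \<pi> p} \<subseteq> Z"
proof -
  have inj: "inj (\<phi> ^^ m)" for m using bij by (simp add: bij_is_inj inj_fn)
  have pk: "eval2 \<pi> ((\<phi> ^^ (k * N)) p) = eval2 \<pi> p" for k
    by (induction k) (simp_all add: funpow_add period)
  have Zk: "(\<phi> ^^ m) p \<in> Z" for m
    using orbit_subset_inv_lattice[OF bij Z p(1)] funpow_in_orbit[of m \<phi> p] by blast
  have "inj (\<lambda>k. (\<phi> ^^ (k * N)) p)"
  proof (rule linorder_injI)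
    fix i j :: nat assume ij: "i < j"
    show "(\<phi> ^^ (i * N)) p \<noteq> (\<phi> ^^ (j * N)) p"
    proof
      assume "(\<phi> ^^ (i * N)) p = (\<phi> ^^ (j * N)) p"
      also have "j * N = i * N + (j - i) * N" using ij by (simp flip: add_mult_distrib)
      finally have "(\<phi> ^^ ((j - i) * N)) p = p"
        using inj[of "i * N"] by (simp add: funpow_add inj_eq)
      moreover have "(j - i) * N > 0" using ij period_pos by simp
      ultimately show False using p(2) torsion_point_iff_periodic[OF bij] by blast
    qed
  qed
  then have "infinite (range (\<lambda>k. (\<phi> ^^ (k * N)) p))" using range_inj_infinite by blast
  moreover have "range (\<lambda>k. (\<phi> ^^ (k * N)) p) \<subseteq> Z \<inter> {r. eval2 \<pi> r = eval2 \<pi> p}"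
    using pk Zk by auto
  ultimately have "infinite (Z \<inter> {r. eval2 \<pi> r = eval2 \<pi> p})" using finite_subset by blast
  moreover obtain u v where "{r. eval2 \<pi> r = eval2 \<pi> p} = range (\<lambda>s. (poly u s, poly v s))"
    using fiber_param by blast
  ultimately show ?thesis
    using parametrised_curve_subset_closed Z unfolding inv_lattice_iff[OF bij] by metis
qed

definition fibers_within :: "('k \<times> 'k) set \<Rightarrow> ('k \<times> 'k) set" where
  "fibers_within Z = {p. {r. eval2 \<pi> r = eval2 \<pi> p} \<subseteq> Z}"

lemma fibers_within_subset: "fibers_within Z \<subseteq> Z"
  by (auto simp: fibers_within_def)

lemma fibers_within_eq_Union:
  "fibers_within Z = \<Union>((\<lambda>t. {p. eval2 \<pi> p = t}) ` {t. {p. eval2 \<pi> p = t} \<subseteq> Z})"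
  by (auto simp: fibers_within_def)

lemma image_fiber:
  "\<phi> ` {r. eval2 \<pi> r = eval2 \<pi> p} = {r. eval2 \<pi> r = eval2 \<pi> (\<phi> p)}"
proof (intro equalityI subsetI)
  fix s assume s: "s \<in> {r. eval2 \<pi> r = eval2 \<pi> (\<phi> p)}"
  obtain r where "s = \<phi> r" using bij by (metis bij_pointE)
  with s show "s \<in> \<phi> ` {r. eval2 \<pi> r = eval2 \<pi> p}" by (auto simp: fiber_iff)
qed (auto simp: fiber_iff)

lemma fibers_within_in_inv_lattice:
  assumes Z: "Z \<in> inv_lattice \<phi>" "Z \<noteq> UNIV"
  shows "fibers_within Z \<in> unions_of (fibers \<pi>) \<inter> inv_lattice \<phi>"
proof
  show "fibers_within Z \<in> unions_of (fibers \<pi>)"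
    unfolding fibers_within_eq_Union unions_of_def fibers_def by blast
  have Z': "closed_subvariety Z" "\<phi> ` Z = Z" using Z(1) by (simp_all add: inv_lattice_iff[OF bij])
  have iff: "\<phi> p \<in> fibers_within Z \<longleftrightarrow> p \<in> fibers_within Z" for p
  proof -
    have "\<phi> p \<in> fibers_within Z \<longleftrightarrow> \<phi> ` {r. eval2 \<pi> r = eval2 \<pi> p} \<subseteq> \<phi> ` Z"
      by (simp add: fibers_within_def image_fiber Z'(2))
    also have "\<dots> \<longleftrightarrow> p \<in> fibers_within Z"
      by (simp add: inj_image_subset_iff[OF bij_is_inj[OF bij]] fibers_within_def)
    finally show ?thesis .
  qed
  have "\<phi> ` fibers_within Z = fibers_within Z"
    by (rule image_eq_selfI[OF bij])
       (auto simp: iff simp flip: iff[of "inv \<phi> _"] simp: surj_f_inv_f[OF bij_is_surj[OF bij]])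
  moreover have "closed_subvariety (fibers_within Z)"
    unfolding fibers_within_eq_Union
    by (rule closed_subvariety_Union)
       (use finite_fibers_in_closed[OF Z'(1) Z(2)] closed_subvariety_fiber in auto)
  ultimately show "fibers_within Z \<in> inv_lattice \<phi>" by (simp add: inv_lattice_iff[OF bij])
qed

lemma generates_lattice_fibers:
  assumes torsion: "\<And>p. torsion_point \<phi> p \<longleftrightarrow> p \<in> T"
    and E: "E \<subseteq> inv_lattice \<phi>"
    and rest: "\<And>Z. Z \<in> inv_lattice \<phi> \<Longrightarrow> Z \<noteq> UNIV \<Longrightarrow>
      finite (Z \<inter> T - fibers_within Z) \<or> T \<in> E \<and> T \<subseteq> Z"
  shows "generates_lattice \<phi>
    (unions_of (fibers \<pi>) \<inter> inv_lattice \<phi> \<union> E \<union> torsion_orbits_on \<phi> T)"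
proof (rule generates_latticeI[OF bij E])
  fix Z assume Z: "Z \<in> inv_lattice \<phi>" "Z \<noteq> UNIV"
  have sub: "Z - fibers_within Z \<subseteq> T"
    using fiber_subset_if_not_torsion[OF Z(1)] torsion by (auto simp: fibers_within_def)
  then have "Z \<inter> T - fibers_within Z = Z - fibers_within Z" by blast
  with rest[OF Z] sub
  have "finite (Z - fibers_within Z) \<and> (\<forall>p\<in>Z - fibers_within Z. torsion_point \<phi> p \<and> p \<in> T) \<or>
      (\<exists>K\<in>E. Z - fibers_within Z \<subseteq> K \<and> K \<subseteq> Z)"
    using torsion by auto
  with fibers_within_in_inv_lattice[OF Z] fibers_within_subset
  show "\<exists>W \<in> unions_of (fibers \<pi>) \<inter> inv_lattice \<phi>. W \<subseteq> Z \<and>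
        (finite (Z - W) \<and> (\<forall>p\<in>Z - W. torsion_point \<phi> p \<and> p \<in> T) \<or>
         (\<exists>K\<in>E. Z - W \<subseteq> K \<and> K \<subseteq> Z))" by blast
qed

text \<open>
  A point lies on the union of the finitely many fibres that are the images of the fibre
  through it; this union is proper because there are infinitely many fibres.
\<close>

lemma Supp_eq_UNIV: "Supp \<phi> = UNIV"
proof -
  have "\<exists>Y. Y \<in> inv_lattice \<phi> \<and> Y \<noteq> UNIV \<and> p \<in> Y" for p
  proof -
    define V where "V = range (\<lambda>i. eval2 \<pi> ((\<phi> ^^ i) p))"
    define Y where "Y = {r. eval2 \<pi> r \<in> V}"
    have pN: "eval2 \<pi> ((\<phi> ^^ (i + k * N)) p) = eval2 \<pi> ((\<phi> ^^ i) p)" for i k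
    proof (induction k)
      case (Suc k)
      have eq: "i + Suc k * N = N + (i + k * N)" by simp
      show ?case unfolding eq funpow_add[of N "i + k * N"] comp_apply period by (rule Suc)
    qed simp
    have "V \<subseteq> (\<lambda>i. eval2 \<pi> ((\<phi> ^^ i) p)) ` {..<N}"
    proof
      fix t assume "t \<in> V"
      then obtain i where "t = eval2 \<pi> ((\<phi> ^^ i) p)" by (auto simp: V_def)
      then have "t = eval2 \<pi> ((\<phi> ^^ (i mod N)) p)"
        using pN[of "i mod N" "i div N"] by simp
      then show "t \<in> (\<lambda>i. eval2 \<pi> ((\<phi> ^^ i) p)) ` {..<N}" using period_pos by simp
    qed
    then have V: "finite V" using finite_subset by blast
    have "Y = \<Union>((\<lambda>t. {r. eval2 \<pi> r = t}) ` V)" by (auto simp: Y_def)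
    then have "closed_subvariety Y"
      using closed_subvariety_Union[of "(\<lambda>t. {r. eval2 \<pi> r = t}) ` V"] V closed_subvariety_fiber
      by auto
    moreover have "\<phi> ` Y = Y"
    proof (rule image_eq_selfI[OF bij])
      fix r assume "r \<in> Y"
      then obtain i where i: "eval2 \<pi> r = eval2 \<pi> ((\<phi> ^^ i) p)" by (auto simp: Y_def V_def)
      then have "eval2 \<pi> (\<phi> r) = eval2 \<pi> ((\<phi> ^^ Suc i) p)" by (simp add: fiber_iff)
      then show "\<phi> r \<in> Y" unfolding Y_def V_def by blast
      have r: "\<phi> (inv \<phi> r) = r" using bij by (simp add: bij_is_surj surj_f_inv_f)
      \<comment> \<open>One step back on fibres is \<open>N - 1\<close> steps forward.\<close>
      obtain M where M: "N = Suc M" using period_pos by (cases N) auto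
      have "eval2 \<pi> (\<phi> (inv \<phi> r)) = eval2 \<pi> (\<phi> ((\<phi> ^^ (i + M)) p))"
        using i pN[of i 1] by (simp add: r M)
      then have "eval2 \<pi> (inv \<phi> r) = eval2 \<pi> ((\<phi> ^^ (i + M)) p)" by (simp only: fiber_iff)
      then show "inv \<phi> r \<in> Y" unfolding Y_def V_def by blast
    qed
    moreover have "Y \<noteq> UNIV"
    proof
      assume "Y = UNIV"
      then have "V = UNIV" using fiber_nonempty by (auto simp: Y_def) (metis UNIV_I mem_Collect_eq)
      with V show False using infinite_UNIV_char_0 by metis
    qed
    moreover have "p \<in> Y" unfolding Y_def V_def by (auto intro: range_eqI[of _ _ 0])
    ultimately show ?thesis by (auto simp: inv_lattice_iff[OF bij])
  qed
  then show ?thesis unfolding Supp_def by blast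
qed

end

section \<open>Exponential polynomials\<close>

lemma power_eq_power_imp_root_of_unity:
  fixes b :: "'k::field"
  assumes "b \<noteq> 0" "b ^ i = b ^ j" "i \<noteq> j"
  shows "root_of_unity b"
proof -
  have *: "root_of_unity b" if "i < j" "b ^ i = b ^ j" for i j
  proof -
    have "b ^ i * b ^ (j - i) = b ^ j" using that(1) by (simp flip: power_add)
    then have "b ^ i * b ^ (j - i) = b ^ i * 1" by (simp only: that(2) mult_1_right)
    then have "b ^ (j - i) = 1" using assms(1) by simp
    with that show ?thesis unfolding root_of_unity_def by (intro exI[of _ "j - i"]) simp
  qed
  show ?thesis
    using assms *[of i j] *[of j i] by (cases "i < j") auto
qed

text \<open>
  The map \<open>s \<mapsto> (m \<mapsto> s (m + 1) - b\<^sup>J s m)\<close> on exponential polynomials \<open>s\<close> lowers the degree of the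
  coefficient of \<open>b\<^sup>J\<^sup>m\<close> and preserves the degrees of all others, because \<open>b\<^sup>j \<noteq> b\<^sup>J\<close> for \<open>j \<noteq> J\<close>.
  This gives an induction on the total degree.
\<close>

lemma exponential_polynomials_independent:
  fixes b :: "'k::field_char_0" and q :: "nat \<Rightarrow> 'k poly"
  assumes b: "b \<noteq> 0" "\<not> root_of_unity b" and A: "finite A"
    and zero: "\<And>m. (\<Sum>j\<in>A. b ^ (j * m) * poly (q j) (of_nat m)) = 0"
  shows "\<forall>j\<in>A. q j = 0"
  using zero
proof (induction "\<Sum>j\<in>A. if q j = 0 then 0 else Suc (degree (q j))" arbitrary: q
    rule: less_induct)
  case less
  show ?case
  proof (rule ccontr)
    assume "\<not> (\<forall>j\<in>A. q j = 0)"
    then obtain i where i: "i \<in> A" "q i \<noteq> 0" by blast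
    define q' where "q' j = smult (b ^ j) (q j \<circ>\<^sub>p [:1, 1:]) - smult (b ^ i) (q j)" for j
    have lead: "coeff (q j \<circ>\<^sub>p [:1, 1:]) (degree (q j)) = lead_coeff (q j)" for j
      using lead_coeff_comp[of "[:1, 1:]" "q j"] by (simp add: degree_pcompose)
    have lead': "coeff (q' j) (degree (q j)) = (b ^ j - b ^ i) * lead_coeff (q j)" for j
      by (simp add: q'_def lead algebra_simps)
    have deg: "degree (q' j) \<le> degree (q j)" for j
      unfolding q'_def
      by (intro degree_diff_le order.trans[OF degree_smult_le]) (simp_all add: degree_pcompose)
    have q'0: "q' j = 0" if "q j = 0" for j using that by (simp add: q'_def)
    have drop: "degree (q' i) < degree (q i)" if "q' i \<noteq> 0"
      using lead'[of i] deg[of i] that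
      by (metis (no_types, lifting) diff_self le_neq_implies_less leading_coeff_0_iff mult_zero_left)
    have "(\<Sum>j\<in>A. if q' j = 0 then 0 else Suc (degree (q' j)))
        < (\<Sum>j\<in>A. if q j = 0 then 0 else Suc (degree (q j)))"
    proof (rule sum_strict_mono_ex1[OF A])
      show "\<forall>j\<in>A. (if q' j = 0 then 0 else Suc (degree (q' j)))
          \<le> (if q j = 0 then 0 else Suc (degree (q j)))"
        using deg q'0 by auto
      show "\<exists>j\<in>A. (if q' j = 0 then 0 else Suc (degree (q' j)))
          < (if q j = 0 then 0 else Suc (degree (q j)))"
        using i drop by (intro bexI[of _ i]) auto
    qed
    moreover have "(\<Sum>j\<in>A. b ^ (j * m) * poly (q' j) (of_nat m)) = 0" for m
    proof -
      have "(\<Sum>j\<in>A. b ^ (j * m) * poly (q' j) (of_nat m))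
          = (\<Sum>j\<in>A. b ^ (j * Suc m) * poly (q j) (of_nat (Suc m)))
            - b ^ i * (\<Sum>j\<in>A. b ^ (j * m) * poly (q j) (of_nat m))"
        unfolding sum_distrib_left sum_subtractf[symmetric]
        by (rule sum.cong) (simp_all add: q'_def poly_pcompose power_add algebra_simps)
      then show ?thesis by (simp only: less.prems mult_zero_right diff_0_right)
    qed
    ultimately have q'_zero: "\<forall>j\<in>A. q' j = 0" by (rule less.hyps)
    have others: "q j = 0" if "j \<in> A" "j \<noteq> i" for j
    proof -
      have "b ^ j \<noteq> b ^ i" using power_eq_power_imp_root_of_unity[OF b(1)] b(2) that(2) by blast
      then show ?thesis using lead'[of j] q'_zero that(1) by simp
    qed
    have "poly (q i) (of_nat m) = 0" for m
    proof -
      have "(\<Sum>j\<in>A. b ^ (j * m) * poly (q j) (of_nat m)) = b ^ (i * m) * poly (q i) (of_nat m)"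
        using A i others by (subst sum.remove[of _ i]) (auto intro: sum.neutral)
      then show ?thesis using less.prems[of m] b(1) by simp
    qed
    then have "range (of_nat :: nat \<Rightarrow> 'k) \<subseteq> {x. poly (q i) x = 0}" by auto
    moreover have "infinite (range (of_nat :: nat \<Rightarrow> 'k))"
      by (simp add: inj_of_nat range_inj_infinite)
    ultimately show False using poly_roots_finite[OF i(2)] finite_subset by blast
  qed
qed

section \<open>Straightened coordinates\<close>

text \<open>
  A polynomial in \<open>k[y][x]\<close> that vanishes on the line \<open>y = v\<close> has all its coefficients, in
  particular the leading one, vanish at \<open>v\<close>.
\<close>

lemma finite_y_lines_in_curve:
  fixes f :: "'k::field_char_0 poly poly"
  assumes "f \<noteq> 0"
  shows "finite {v. \<forall>p. snd p = v \<longrightarrow> eval2 f p = 0}"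
proof (rule finite_subset[OF _ poly_roots_finite])
  have ev: "eval2 g (u, v) = poly (map_poly (\<lambda>r. poly r v) g) u" for g :: "'k poly poly" and u v
    by (induction g) (simp_all add: eval2_0 eval2_pCons map_poly_pCons)
  show "{v. \<forall>p. snd p = v \<longrightarrow> eval2 f p = 0} \<subseteq> {v. poly (lead_coeff f) v = 0}"
  proof clarify
    fix v assume "\<forall>p. snd p = v \<longrightarrow> eval2 f p = 0"
    then have "poly (map_poly (\<lambda>r. poly r v) f) u = 0" for u by (simp flip: ev)
    then have "map_poly (\<lambda>r. poly r v) f = 0" using poly_all_0_iff_0 by blast
    then have "coeff (map_poly (\<lambda>r. poly r v) f) (degree f) = 0" by simp
    then show "poly (lead_coeff f) v = 0" by (simp add: coeff_map_poly)
  qed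
  show "lead_coeff f \<noteq> 0" using assms by simp
qed

lemma y_lines_eq_fibers: "y_lines = fibers ([:[:0, 1:]:] :: 'k::comm_ring_1 poly poly)"
  by (auto simp: y_lines_def fibers_def zero_locus_def)

text \<open>
  The functions \<open>X = x - q(y)\<close> and \<open>Y = y - d\<close> are coordinates of the plane, in which
  \<open>\<phi>\<close> becomes \<open>(a X + h, b Y)\<close>, where \<open>h\<close> depends only on \<open>y\<close> and is an eigenvector of \<open>\<phi>\<close> for \<open>a\<close>.
\<close>

locale straightened_jonquieres =
  fixes \<phi> :: "'k::field_char_0 \<times> 'k \<Rightarrow> 'k \<times> 'k" and a b d :: 'k and q h :: "'k poly"
  assumes a_nz: "a \<noteq> 0" and b_nz: "b \<noteq> 0" and bij: "bij \<phi>"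
    and X_step: "eval2 [:- q, 1:] (\<phi> p) = a * eval2 [:- q, 1:] p + poly h (snd p)"
    and Y_step: "snd (\<phi> p) - d = b * (snd p - d)"
    and h_step: "poly h (snd (\<phi> p)) = a * poly h (snd p)"
begin

abbreviation "X \<equiv> eval2 [:- q, 1:]"
abbreviation "Y \<equiv> \<lambda>p. snd p - d"

lemma X_eq: "X p = fst p - poly q (snd p)"
  by simp

lemma coordinates_eqI: "X p = X r \<Longrightarrow> Y p = Y r \<Longrightarrow> p = r"
  by (simp add: prod_eq_iff)

lemma Y_iter: "Y ((\<phi> ^^ m) p) = b ^ m * Y p"
  by (induction m) (simp_all add: Y_step)

lemma h_iter: "poly h (snd ((\<phi> ^^ m) p)) = a ^ m * poly h (snd p)"
  by (induction m) (simp_all add: h_step)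

lemma X_iter: "a * X ((\<phi> ^^ m) p) = a ^ m * (a * X p + of_nat m * poly h (snd p))"
proof (induction m)
  case (Suc m)
  have "a * X ((\<phi> ^^ Suc m) p) = a * (a * X ((\<phi> ^^ m) p) + poly h (snd ((\<phi> ^^ m) p)))"
    by (simp only: funpow.simps comp_apply X_step)
  also have "\<dots> = a * (a ^ m * (a * X p + of_nat m * poly h (snd p)) + a ^ m * poly h (snd p))"
    by (simp only: Suc h_iter)
  also have "\<dots> = a ^ Suc m * (a * X p + of_nat (Suc m) * poly h (snd p))"
    by (simp add: algebra_simps)
  finally show ?case .
qed simp

lemma X_iter_h0: "poly h (snd p) = 0 \<Longrightarrow> X ((\<phi> ^^ m) p) = a ^ m * X p"
  using X_iter[of m p] a_nz by (simp del: eval2_simps)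

lemma periodic_if:
  assumes "a ^ N = 1 \<or> X p = 0" "b ^ N = 1 \<or> Y p = 0" "poly h (snd p) = 0"
  shows "(\<phi> ^^ N) p = p"
  by (rule coordinates_eqI) (use assms X_iter_h0[OF assms(3), of N] Y_iter[of N p] in auto)

lemma finite_order_if:
  assumes "root_of_unity a" "root_of_unity b" "h = 0"
  shows "finite_order \<phi>"
proof -
  from assms obtain k l where kl: "k > 0" "a ^ k = 1" "l > 0" "b ^ l = 1"
    by (auto simp: root_of_unity_def)
  have "a ^ (k * l) = 1" by (simp add: power_mult kl)
  moreover have "b ^ (k * l) = 1" by (simp add: power_mult mult.commute[of k] kl)
  ultimately have "(\<phi> ^^ (k * l)) p = p" for p using assms(3) by (intro periodic_if) auto
  then show ?thesis unfolding finite_order_def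
    using kl by (intro exI[of _ "k * l"]) (auto simp: fun_eq_iff)
qed

lemma invariant_locusI:
  assumes "\<And>p. eval2 f (\<phi> p) = e * eval2 f p" "e \<noteq> 0"
  shows "zero_locus {f} \<in> inv_lattice \<phi>"
proof -
  have iff: "\<phi> p \<in> zero_locus {f} \<longleftrightarrow> p \<in> zero_locus {f}" for p
    using assms by (simp add: zero_locus_def)
  have "\<phi> ` zero_locus {f} = zero_locus {f}"
    by (rule image_eq_selfI[OF bij])
       (auto simp: iff simp flip: iff[of "inv \<phi> _"] simp: surj_f_inv_f[OF bij_is_surj[OF bij]])
  then show ?thesis by (simp add: inv_lattice_iff[OF bij] closed_subvariety_zero_locus)
qed

lemma y_line_param: "{p :: 'k \<times> 'k. snd p = t} = range (\<lambda>s. (poly [:0, 1:] s, poly [:t:] s))"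
  by auto

lemma X_fiber_param: "{p. X p = t} = range (\<lambda>s. (poly (q + [:t:]) s, poly [:0, 1:] s))"
  by (force simp: image_iff)

subsection \<open>The fibration by lines \<open>y = y\<^sub>0\<close>\<close>

lemma y_fibration:
  assumes N: "N > 0" "b ^ N = 1"
  shows "periodic_fibration \<phi> [:[:0, 1:]:] N"
proof
  show "bij \<phi>" by (rule bij)
  fix p r :: "'k \<times> 'k" and t :: 'k and f :: "'k poly poly"
  show "eval2 [:[:0, 1:]:] (\<phi> p) = eval2 [:[:0, 1:]:] (\<phi> r) \<longleftrightarrow>
      eval2 [:[:0, 1:]:] p = eval2 [:[:0, 1:]:] r"
    using Y_step[of p] Y_step[of r] b_nz by (simp add: diff_eq_eq)
  show "N > 0" by (rule N)
  show "eval2 [:[:0, 1:]:] ((\<phi> ^^ N) p) = eval2 [:[:0, 1:]:] p"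
    using Y_iter[of N p] N by simp
  show "\<exists>u v. {p. eval2 [:[:0, 1:]:] p = t} = range (\<lambda>s. (poly u s, poly v s))"
    using y_line_param[of t] by (intro exI[of _ "[:0, 1:]"] exI[of _ "[:t:]"]) simp
  show "finite {t. \<forall>p. eval2 [:[:0, 1:]:] p = t \<longrightarrow> eval2 f p = 0}" if "f \<noteq> 0"
    using finite_y_lines_in_curve[OF that] by simp
qed

lemma torsion_iff_h:
  assumes "root_of_unity a" "root_of_unity b"
  shows "torsion_point \<phi> p \<longleftrightarrow> poly h (snd p) = 0"
proof -
  from assms obtain k l where kl: "k > 0" "a ^ k = 1" "l > 0" "b ^ l = 1"
    by (auto simp: root_of_unity_def)
  show ?thesis unfolding torsion_point_iff_periodic[OF bij]
  proof
    assume "\<exists>m>0. (\<phi> ^^ m) p = p"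
    then obtain m where m: "m > 0" "(\<phi> ^^ m) p = p" by blast
    have "a * X ((\<phi> ^^ (k * m)) p) = a * X p + of_nat (k * m) * poly h (snd p)"
      unfolding X_iter by (simp add: power_mult kl)
    then have "of_nat (k * m) * poly h (snd p) = 0"
      unfolding funpow_periodic[OF m(2)] by simp
    with m kl show "poly h (snd p) = 0" by simp
  next
    assume "poly h (snd p) = 0"
    moreover have "a ^ (k * l) = 1" by (simp add: power_mult kl)
    moreover have "b ^ (k * l) = 1" by (simp add: power_mult mult.commute[of k] kl)
    ultimately have "(\<phi> ^^ (k * l)) p = p" by (intro periodic_if) auto
    with kl show "\<exists>m>0. (\<phi> ^^ m) p = p" by (intro exI[of _ "k * l"]) simp
  qed
qed

text \<open>
  A line on which \<open>h\<close> vanishes and which \<open>Z\<close> does not contain meets \<open>Z\<close> in finitely many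
  points, and there are finitely many such lines. So removing from \<open>Z\<close> its lines \<open>y = y\<^sub>0\<close> leaves
  a finite set of torsion points.
\<close>

theorem roots_of_unity_case:
  assumes a: "root_of_unity a" and b: "root_of_unity b" and h: "h \<noteq> 0"
  shows "Supp \<phi> = UNIV"
    and "\<exists>U \<subseteq> unions_of y_lines.
      generates_lattice \<phi> (U \<union> torsion_orbits_on \<phi> (zero_locus {[:h:]}))"
    and "torsion_point \<phi> p \<longleftrightarrow> p \<in> zero_locus {[:h:]}"
proof -
  from b obtain N where N: "N > 0" "b ^ N = 1" by (auto simp: root_of_unity_def)
  interpret fib: periodic_fibration \<phi> "[:[:0, 1:]:]" N by (rule y_fibration[OF N])
  show "Supp \<phi> = UNIV" by (rule fib.Supp_eq_UNIV)
  show tors: "torsion_point \<phi> p \<longleftrightarrow> p \<in> zero_locus {[:h:]}" for p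
    using torsion_iff_h[OF a b] by (simp add: zero_locus_def)
  have "finite (Z \<inter> zero_locus {[:h:]} - fib.fibers_within Z)" if Z: "Z \<in> inv_lattice \<phi>" for Z
  proof -
    have "finite (Z \<inter> {p. snd p = v})" if "\<not> {p. snd p = v} \<subseteq> Z" for v
      using parametrised_curve_subset_closed[of Z "[:0, 1:]" "[:v:]"] Z that
      unfolding y_line_param[symmetric] by (auto simp: inv_lattice_iff[OF bij])
    then have "finite (\<Union>v\<in>{v. poly h v = 0}. if {p. snd p = v} \<subseteq> Z then {} else Z \<inter> {p. snd p = v})"
      using poly_roots_finite[OF h] by (intro finite_UN_I) auto
    then show ?thesis
      by (rule finite_subset[rotated]) (auto simp: zero_locus_def fib.fibers_within_def)
  qed
  then have "generates_lattice \<phi> (unions_of (fibers [:[:0, 1:]:]) \<inter> inv_lattice \<phi> \<union> {}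
      \<union> torsion_orbits_on \<phi> (zero_locus {[:h:]}))"
    by (intro fib.generates_lattice_fibers tors) auto
  then show "\<exists>U \<subseteq> unions_of y_lines.
      generates_lattice \<phi> (U \<union> torsion_orbits_on \<phi> (zero_locus {[:h:]}))"
    unfolding y_lines_eq_fibers[symmetric]
    by (intro exI[of _ "unions_of y_lines \<inter> inv_lattice \<phi>"]) simp
qed

text \<open>
  Here \<open>h\<close> vanishes, so \<open>X\<close> is multiplied by \<open>a\<close>, and the torsion locus is the irreducible curve
  \<open>X = 0\<close>: an invariant set contains it or meets it in finitely many points.
\<close>

theorem b_root_of_unity_case:
  assumes a: "\<not> root_of_unity a" and b: "root_of_unity b"
  shows "Supp \<phi> = UNIV"
    and "\<exists>U \<subseteq> unions_of y_lines. generates_lattice \<phi>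
      ({zero_locus {[:- q, 1:]}} \<union> U \<union> torsion_orbits_on \<phi> (zero_locus {[:- q, 1:]}))"
    and "torsion_point \<phi> p \<longleftrightarrow> p \<in> zero_locus {[:- q, 1:]}"
proof -
  from b obtain N where N: "N > 0" "b ^ N = 1" by (auto simp: root_of_unity_def)
  interpret fib: periodic_fibration \<phi> "[:[:0, 1:]:]" N by (rule y_fibration[OF N])
  show "Supp \<phi> = UNIV" by (rule fib.Supp_eq_UNIV)
  have a_pow: "a ^ m \<noteq> 1" if "m > 0" for m using a that unfolding root_of_unity_def by blast
  \<comment> \<open>\<open>\<phi>\<^sup>N\<close> fixes \<open>y\<close>, hence \<open>h\<close>, but multiplies \<open>h\<close> by \<open>a\<^sup>N \<noteq> 1\<close>.\<close>
  have h0: "poly h (snd p) = 0" for p :: "'k \<times> 'k"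
    using h_iter[of N p] Y_iter[of N p] N a_pow[OF N(1)] by auto
  let ?T = "zero_locus {[:- q, 1:]}"
  have T: "?T = {p. X p = 0}" by (simp add: zero_locus_def)
  show tors: "torsion_point \<phi> p \<longleftrightarrow> p \<in> ?T" for p
    unfolding torsion_point_iff_periodic[OF bij] T mem_Collect_eq
  proof
    assume "\<exists>m>0. (\<phi> ^^ m) p = p"
    then obtain m where "m > 0" "(\<phi> ^^ m) p = p" by blast
    then show "X p = 0" using X_iter_h0[OF h0, of m p] a_pow by (auto simp del: eval2_simps)
  next
    assume "X p = 0"
    then show "\<exists>m>0. (\<phi> ^^ m) p = p" using N h0 by (intro exI[of _ N] conjI periodic_if) auto
  qed
  have "?T \<in> inv_lattice \<phi>"
    by (rule invariant_locusI[OF _ a_nz]) (simp only: X_step h0 add_0_right)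
  moreover have "finite (Z \<inter> ?T) \<or> ?T \<subseteq> Z" if "Z \<in> inv_lattice \<phi>" for Z
    using parametrised_curve_subset_closed[of Z "q + [:0:]" "[:0, 1:]"] that
    unfolding T X_fiber_param by (auto simp: inv_lattice_iff[OF bij])
  ultimately have "generates_lattice \<phi> (unions_of (fibers [:[:0, 1:]:]) \<inter> inv_lattice \<phi> \<union> {?T}
      \<union> torsion_orbits_on \<phi> ?T)"
    by (intro fib.generates_lattice_fibers tors) auto
  then show "\<exists>U \<subseteq> unions_of y_lines. generates_lattice \<phi> ({?T} \<union> U \<union> torsion_orbits_on \<phi> ?T)"
    unfolding y_lines_eq_fibers[symmetric]
    by (intro exI[of _ "unions_of y_lines \<inter> inv_lattice \<phi>"]) (simp add: Un_commute)
qed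

subsection \<open>The fibration by the curves \<open>X = t\<close>\<close>

lemma X_fibration:
  assumes h: "h = 0" and N: "N > 0" "a ^ N = 1"
  shows "periodic_fibration \<phi> [:- q, 1:] N"
proof
  show "bij \<phi>" by (rule bij)
  fix p r :: "'k \<times> 'k" and t :: 'k and f :: "'k poly poly"
  show "X (\<phi> p) = X (\<phi> r) \<longleftrightarrow> X p = X r"
    unfolding X_step h using a_nz by (simp del: eval2_simps)
  show "N > 0" by (rule N)
  show "X ((\<phi> ^^ N) p) = X p"
    using X_iter_h0[of p N] N h by (simp del: eval2_simps)
  show "\<exists>u v. {p. X p = t} = range (\<lambda>s. (poly u s, poly v s))"
    using X_fiber_param by blast
  \<comment> \<open>If \<open>f\<close> vanishes on the fibre over \<open>t\<close>, then \<open>q + t\<close> is a root of \<open>f\<close> in the domain \<open>k[y]\<close>.\<close>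
  show "finite {t. \<forall>p. X p = t \<longrightarrow> eval2 f p = 0}" if "f \<noteq> 0"
  proof (rule finite_subset)
    have ev: "eval2 g (poly r s, s) = poly (poly g r) s" for g :: "'k poly poly" and r s
      by (induction g) (simp_all add: eval2_0 eval2_pCons)
    show "{t. \<forall>p. X p = t \<longrightarrow> eval2 f p = 0} \<subseteq> (\<lambda>t. q + [:t:]) -` {r. poly f r = 0}"
    proof
      fix t assume "t \<in> {t. \<forall>p. X p = t \<longrightarrow> eval2 f p = 0}"
      then have "poly (poly f (q + [:t:])) s = 0" for s
        using ev[of f "q + [:t:]" s] by simp
      then have "poly f (q + [:t:]) = 0" using poly_all_0_iff_0 by blast
      then show "t \<in> (\<lambda>t. q + [:t:]) -` {r. poly f r = 0}" by simp
    qed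
    show "finite ((\<lambda>t. q + [:t:]) -` {r. poly f r = 0})"
      by (rule finite_vimageI[OF poly_roots_finite[OF that]]) (simp add: inj_on_def)
  qed
qed

lemma Y_locus: "zero_locus {[:[:- d, 1:]:]} = {p. Y p = 0}"
  by (simp add: zero_locus_def)

lemma Y_locus_in_inv_lattice: "zero_locus {[:[:- d, 1:]:]} \<in> inv_lattice \<phi>"
  by (rule invariant_locusI[OF _ b_nz]) (use Y_step in simp)

lemma finite_or_Y_locus_subset:
  assumes "Z \<in> inv_lattice \<phi>"
  shows "finite (Z \<inter> {p. Y p = 0}) \<or> {p. Y p = 0} \<subseteq> Z"
  using parametrised_curve_subset_closed[of Z "[:0, 1:]" "[:d:]"] assms
  unfolding y_line_param[symmetric] by (auto simp: inv_lattice_iff[OF bij])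

text \<open>
  With \<open>h = 0\<close> the map is diagonal, so this is the previous argument with \<open>X\<close> and \<open>Y\<close> exchanged.
\<close>

theorem a_root_of_unity_case_h_zero:
  assumes a: "root_of_unity a" and b: "\<not> root_of_unity b" and h: "h = 0"
  shows "Supp \<phi> = UNIV"
    and "\<exists>U \<subseteq> unions_of (fibers [:- q, 1:]). generates_lattice \<phi>
      (U \<union> {zero_locus {[:[:- d, 1:]:]}} \<union> torsion_orbits_on \<phi> (zero_locus {[:[:- d, 1:]:]}))"
    and "torsion_point \<phi> p \<longleftrightarrow> p \<in> zero_locus {[:[:- d, 1:]:]}"
proof -
  from a obtain N where N: "N > 0" "a ^ N = 1" by (auto simp: root_of_unity_def)
  interpret fib: periodic_fibration \<phi> "[:- q, 1:]" N by (rule X_fibration[OF h N])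
  show "Supp \<phi> = UNIV" by (rule fib.Supp_eq_UNIV)
  let ?T = "zero_locus {[:[:- d, 1:]:]}"
  show tors: "torsion_point \<phi> p \<longleftrightarrow> p \<in> ?T" for p
    unfolding torsion_point_iff_periodic[OF bij] Y_locus mem_Collect_eq
  proof
    assume "\<exists>m>0. (\<phi> ^^ m) p = p"
    then obtain m where "m > 0" "(\<phi> ^^ m) p = p" by blast
    moreover from this have "(b ^ m - 1) * Y p = 0"
      using Y_iter[of m p] by (simp add: left_diff_distrib)
    moreover have "b ^ m \<noteq> 1" using \<open>m > 0\<close> b unfolding root_of_unity_def by blast
    ultimately show "Y p = 0" by auto
  next
    assume "Y p = 0"
    then show "\<exists>m>0. (\<phi> ^^ m) p = p" using N h by (intro exI[of _ N] conjI periodic_if) auto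
  qed
  have "generates_lattice \<phi> (unions_of (fibers [:- q, 1:]) \<inter> inv_lattice \<phi> \<union> {?T}
      \<union> torsion_orbits_on \<phi> ?T)"
  proof (intro fib.generates_lattice_fibers tors)
    show "{?T} \<subseteq> inv_lattice \<phi>" using Y_locus_in_inv_lattice by simp
    fix Z assume "Z \<in> inv_lattice \<phi>"
    from finite_or_Y_locus_subset[OF this]
    show "finite (Z \<inter> ?T - fib.fibers_within Z) \<or> ?T \<in> {?T} \<and> ?T \<subseteq> Z"
      unfolding Y_locus by auto
  qed
  then show "\<exists>U \<subseteq> unions_of (fibers [:- q, 1:]). generates_lattice \<phi>
      (U \<union> {?T} \<union> torsion_orbits_on \<phi> ?T)"
    by (intro exI[of _ "unions_of (fibers [:- q, 1:]) \<inter> inv_lattice \<phi>"]) simp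
qed

text \<open>
  On the orbit of a point \<open>p\<close> with \<open>Y p \<noteq> 0\<close>, an equation of \<open>Z\<close> is a polynomial expression in \<open>m\<close> and
  \<open>b\<^sup>m\<close>; its vanishing for all \<open>m\<close> makes the polynomial zero, so the orbit is Zariski dense.
\<close>

lemma dense_orbit:
  assumes b: "\<not> root_of_unity b" and a: "a = 1" and h: "h = [:e:]" "e \<noteq> 0"
    and Z: "Z \<in> inv_lattice \<phi>" and p: "p \<in> Z" "Y p \<noteq> 0"
  shows "Z = UNIV"
proof -
  obtain S where S: "Z = zero_locus S"
    using Z by (auto simp: inv_lattice_iff[OF bij] closed_subvariety_def)
  have "eval2 f r = 0" if f: "f \<in> S" for f r
  proof -
    \<comment> \<open>\<open>(u, v)\<close> sends \<open>(t, s)\<close> to the point with \<open>X = X p + s e\<close> and \<open>Y = t (Y p)\<close>,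
       so it sends \<open>(b\<^sup>m, m)\<close> to \<open>\<phi>\<^sup>m p\<close>.\<close>
    define v :: "'k poly poly" where "v = [:[:d:], [:Y p:]:]"
    have ev_v: "eval2 v (t, s) = d + t * Y p" for t s by (simp add: v_def)
    obtain w where w: "\<And>z. eval2 [:q:] (eval2 0 z, eval2 v z) = eval2 w z"
      using eval2_compose_ex by blast
    define u where "u = [:[:X p, e:]:] + w"
    have ev_u: "eval2 u (t, s) = X p + s * e + poly q (d + t * Y p)" for t s
      using w[of "(t, s)"] by (simp add: u_def eval2_add ev_v del: eval2_simps(2))
    obtain g where g: "\<And>z. eval2 f (eval2 u z, eval2 v z) = eval2 g z"
      using eval2_compose_ex by blast
    have orb: "(eval2 u (b ^ m, of_nat m), eval2 v (b ^ m, of_nat m)) = (\<phi> ^^ m) p" for m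
    proof (rule coordinates_eqI)
      show "X (eval2 u (b ^ m, of_nat m), eval2 v (b ^ m, of_nat m)) = X ((\<phi> ^^ m) p)"
        using X_iter[of m p] by (simp add: a h X_eq ev_u ev_v)
      show "Y (eval2 u (b ^ m, of_nat m), eval2 v (b ^ m, of_nat m)) = Y ((\<phi> ^^ m) p)"
        by (simp add: Y_iter ev_v)
    qed
    have "(\<phi> ^^ m) p \<in> Z" for m
      using orbit_subset_inv_lattice[OF bij Z p(1)] funpow_in_orbit[of m \<phi> p] by blast
    then have g0: "eval2 g (b ^ m, of_nat m) = 0" for m
      using g[of "(b ^ m, of_nat m)"] f unfolding orb by (auto simp: S zero_locus_def)
    have ev_g: "eval2 g (t, s) = (\<Sum>j\<le>degree g. t ^ j * poly (coeff g j) s)" for t s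
      by (simp add: eval2_def poly_altdef[of g] poly_sum mult.commute flip: poly_const_pow)
    have "\<forall>j\<in>{..degree g}. coeff g j = 0"
      using g0 unfolding ev_g
      by (intro exponential_polynomials_independent[OF b_nz b]) (simp_all add: power_mult mult.commute)
    then have "eval2 g z = 0" for z by (cases z) (simp add: ev_g)
    moreover have "r = (eval2 u z, eval2 v z)" if "z = (Y r / Y p, (X r - X p) / e)" for z
      by (rule coordinates_eqI) (use p(2) h(2) in \<open>simp_all add: that ev_u ev_v\<close>)
    ultimately show ?thesis using g by metis
  qed
  then show ?thesis by (auto simp: S zero_locus_def)
qed

text \<open>
  Some \<open>\<phi>\<^sup>N\<close> leaves \<open>h\<close> invariant while it moves \<open>y\<close> through infinitely many values.
\<close>

lemma h_constant:
  assumes a: "root_of_unity a" and b: "\<not> root_of_unity b" and h: "h \<noteq> 0"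
  obtains e where "h = [:e:]" "e \<noteq> 0" "a = 1"
proof -
  from a obtain N where N: "N > 0" "a ^ N = 1" by (auto simp: root_of_unity_def)
  define e where "e = poly h (d + 1)"
  \<comment> \<open>\<open>h\<close> takes the same value at all points of the infinite orbit of \<open>d + 1\<close> under \<open>\<phi>\<^sup>N\<close>.\<close>
  have const: "poly (h - [:e:]) (d + b ^ (N * k)) = 0" for k
  proof -
    have "snd ((\<phi> ^^ (N * k)) (0, d + 1)) = d + b ^ (N * k)"
      using Y_iter[of "N * k" "(0, d + 1)"] by (simp add: algebra_simps)
    then show ?thesis
      using h_iter[of "N * k" "(0, d + 1)"] N by (simp add: e_def power_mult)
  qed
  have "inj (\<lambda>k. d + b ^ (N * k))"
  proof (rule injI)
    fix i j assume "d + b ^ (N * i) = d + b ^ (N * j)"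
    then have "b ^ (N * i) = b ^ (N * j)" by simp
    then have "N * i = N * j" using power_eq_power_imp_root_of_unity[OF b_nz] b by blast
    with N(1) show "i = j" by simp
  qed
  then have "infinite (range (\<lambda>k. d + b ^ (N * k)))" using range_inj_infinite by blast
  moreover have "range (\<lambda>k. d + b ^ (N * k)) \<subseteq> {x. poly (h - [:e:]) x = 0}" using const by auto
  ultimately have "h - [:e:] = 0" using poly_roots_finite finite_subset by blast
  then have he: "h = [:e:]" by simp
  moreover from this h have "e \<noteq> 0" by auto
  moreover have "a = 1" using h_step[of "(0, 0)"] he \<open>e \<noteq> 0\<close> by simp
  ultimately show thesis by (rule that)
qed

text \<open>
  By density of the other orbits, a proper invariant closed set lies in the line \<open>Y = 0\<close>. As \<open>\<phi>\<close>
  translates \<open>X\<close> by a nonzero constant, every orbit is infinite, so the set is the line or empty.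
\<close>

theorem a_root_of_unity_case_h_nonzero:
  assumes a: "root_of_unity a" and b: "\<not> root_of_unity b" and h: "h \<noteq> 0"
  shows "\<exists>U \<subseteq> unions_of (fibers [:- q, 1:]). generates_lattice \<phi>
      (U \<union> {zero_locus {[:[:- d, 1:]:]}} \<union> torsion_orbits_on \<phi> (zero_locus {[:[:- d, 1:]:]}))"
proof -
  let ?T = "zero_locus {[:[:- d, 1:]:]}"
  from h_constant[OF assms] obtain e where e: "h = [:e:]" "e \<noteq> 0" "a = 1" by blast
  have no_torsion: "\<not> torsion_point \<phi> p" for p
    unfolding torsion_point_iff_periodic[OF bij]
  proof safe
    fix m :: nat assume "m > 0" "(\<phi> ^^ m) p = p"
    then show False using X_iter[of m p] e by (simp del: eval2_simps(2))
  qed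
  have "generates_lattice \<phi> (unions_of (fibers [:- q, 1:]) \<inter> inv_lattice \<phi> \<union> {?T}
      \<union> torsion_orbits_on \<phi> ?T)"
  proof (rule generates_latticeI[OF bij])
    show "{?T} \<subseteq> inv_lattice \<phi>" using Y_locus_in_inv_lattice by simp
    fix Z assume Z: "Z \<in> inv_lattice \<phi>" "Z \<noteq> UNIV"
    have sub: "Z \<subseteq> ?T"
      unfolding Y_locus using dense_orbit[OF b e(3,1,2) Z(1)] Z(2) by blast
    have "Z = {} \<or> ?T \<subseteq> Z"
    proof (rule ccontr)
      assume *: "\<not> (Z = {} \<or> ?T \<subseteq> Z)"
      then obtain p where p: "p \<in> Z" by blast
      have "finite (Z \<inter> ?T)" using * finite_or_Y_locus_subset[OF Z(1)] unfolding Y_locus by blast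
      with sub have "finite Z" by (simp add: Int_absorb2)
      moreover have "orbit \<phi> p \<subseteq> Z"
        using orbit_subset_inv_lattice[OF bij Z(1) p] .
      ultimately show False using no_torsion[of p] finite_subset unfolding torsion_point_def by blast
    qed
    moreover have "{} \<in> unions_of (fibers [:- q, 1:]) \<inter> inv_lattice \<phi>"
      by (auto simp: unions_of_def inv_lattice_iff[OF bij] closed_subvariety_empty)
    ultimately show "\<exists>W \<in> unions_of (fibers [:- q, 1:]) \<inter> inv_lattice \<phi>. W \<subseteq> Z \<and>
        (finite (Z - W) \<and> (\<forall>p\<in>Z - W. torsion_point \<phi> p \<and> p \<in> ?T) \<or>
         (\<exists>K\<in>{?T}. Z - W \<subseteq> K \<and> K \<subseteq> Z))"
      using sub by (intro bexI[of _ "{}"]) auto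
  qed
  then show ?thesis
    by (intro exI[of _ "unions_of (fibers [:- q, 1:]) \<inter> inv_lattice \<phi>"]) simp
qed

lemma X_equivariant:
  assumes a: "root_of_unity a" and b: "\<not> root_of_unity b"
  shows "equivariant \<phi> [:- q, 1:]"
proof -
  have "\<exists>e. h = [:e:]"
  proof (cases "h = 0")
    case True
    then show ?thesis by (intro exI[of _ 0]) simp
  next
    case False
    then show ?thesis using h_constant[OF a b] by metis
  qed
  then obtain e where e: "h = [:e:]" by blast
  have "poly [:e, a:] \<circ> poly [:- e / a, 1 / a:] = id" "poly [:- e / a, 1 / a:] \<circ> poly [:e, a:] = id"
    using a_nz by (auto simp: fun_eq_iff field_simps)
  then have "poly [:e, a:] \<in> Aut_A1" unfolding Aut_A1_def by blast
  moreover have "X \<circ> \<phi> = poly [:e, a:] \<circ> X"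
    by (rule ext) (simp only: comp_apply X_step, simp add: e)
  ultimately show ?thesis unfolding equivariant_def by blast
qed

end

section \<open>Straightening a de Jonquieres map\<close>

lemma bij_if_in_Aut_A2: "\<phi> \<in> Aut_A2 \<Longrightarrow> bij \<phi>"
  unfolding Aut_A2_def using o_bij by blast

text \<open>
  Substituting \<open>by + c\<close> for \<open>y\<close> multiplies the \<open>i\<close>-th power of \<open>ytilde b c\<close> by \<open>b\<^sup>i\<close>. The
  correction term of \<open>xtilde\<close> has \<open>i\<close>-th coefficient \<open>\<alpha>\<^sub>i / (b\<^sup>i - a)\<close>, so passing to \<open>xtilde\<close> removes the
  \<open>i\<close>-th term of \<open>P\<close> when \<open>b\<^sup>i \<noteq> a\<close>; what remains is \<open>h1\<close>.
\<close>

lemma straightened_jonquieres_jonq: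
  fixes a b c :: "'k::field_char_0"
  assumes J: "jonq a b c P \<in> J n"
    and bc: "b \<noteq> 1 \<or> (b, c) = (1, 0)"
    and P: "P = (\<Sum>i\<le>n. smult (\<alpha> i) (ytilde b c ^ i))"
    and q: "q = (\<Sum>i | i \<le> n \<and> a \<noteq> b ^ i. smult (\<alpha> i / (b ^ i - a)) (ytilde b c ^ i))"
    and d: "d = (if b = 1 then 0 else c / (1 - b))"
  shows "straightened_jonquieres (jonq a b c P) a b d q (h1 a b c n \<alpha>)"
proof
  show nz: "a \<noteq> 0" "b \<noteq> 0" using J by (simp_all add: jonq_in_J_iff)
  show "bij (jonq a b c P)" using J J_subset_Aut_A2 bij_if_in_Aut_A2 by blast
  define y where "y v = poly (ytilde b c) v" for v
  have y_eq: "y v = v - d" for v by (simp add: y_def ytilde_def d)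
  have y_step: "y (b * v + c) = b * y v" for v
    using bc by (auto simp: y_eq d field_simps)
  let ?A = "{i. i \<le> n \<and> a \<noteq> b ^ i}" and ?B = "{i. i \<le> n \<and> a = b ^ i}"
  have qv: "poly q v = (\<Sum>i\<in>?A. \<alpha> i / (b ^ i - a) * y v ^ i)" for v
    by (simp add: q poly_sum y_def)
  have hv: "poly (h1 a b c n \<alpha>) v = (\<Sum>i\<in>?B. \<alpha> i * y v ^ i)" for v
    by (simp add: h1_def poly_sum y_def)
  have Pv: "poly P v = (\<Sum>i\<in>?A. \<alpha> i * y v ^ i) + (\<Sum>i\<in>?B. \<alpha> i * y v ^ i)" for v
  proof -
    have "poly P v = (\<Sum>i\<in>?A \<union> ?B. \<alpha> i * y v ^ i)"
      unfolding P poly_sum by (rule sum.cong) (auto simp: y_def)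
    then show ?thesis by (subst (asm) sum.union_disjoint) auto
  qed
  have q_step: "poly q (b * v + c) - a * poly q v = (\<Sum>i\<in>?A. \<alpha> i * y v ^ i)" for v
  proof -
    have "\<alpha> i / (b ^ i - a) * (b * y v) ^ i - a * (\<alpha> i / (b ^ i - a) * y v ^ i) = \<alpha> i * y v ^ i"
      if "i \<in> ?A" for i
    proof -
      have neq: "b ^ i - a \<noteq> 0" using that by auto
      have "k * (b * y v) ^ i - a * (k * y v ^ i) = k * (b ^ i - a) * y v ^ i" for k
        by (simp add: power_mult_distrib algebra_simps)
      moreover from neq have "\<alpha> i / (b ^ i - a) * (b ^ i - a) = \<alpha> i" by simp
      ultimately show ?thesis by (simp only:)
    qed
    then show ?thesis
      unfolding qv y_step sum_distrib_left sum_subtractf[symmetric] by (intro sum.cong) auto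
  qed
  fix p :: "'k \<times> 'k"
  obtain u v where p: "p = (u, v)" by (cases p)
  show "eval2 [:- q, 1:] (jonq a b c P p) = a * eval2 [:- q, 1:] p + poly (h1 a b c n \<alpha>) (snd p)"
    using q_step[of v] by (simp add: p jonq_apply Pv hv algebra_simps)
  show "snd (jonq a b c P p) - d = b * (snd p - d)"
    using y_step[of v] by (simp add: p jonq_apply y_eq)
  show "poly (h1 a b c n \<alpha>) (snd (jonq a b c P p)) = a * poly (h1 a b c n \<alpha>) (snd p)"
    by (simp add: p jonq_apply hv y_step sum_distrib_left power_mult_distrib mult.left_commute
        cong: sum.cong_simp)
qed

theorem proposition5p10:
  fixes a b c :: "'k::{alg_closed_field, field_char_0}"
    and P :: "'k poly" and n :: nat
    and \<phi> :: "'k \<times> 'k \<Rightarrow> 'k \<times> 'k"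
    and \<alpha> :: "nat \<Rightarrow> 'k"
    and xt :: "'k poly poly" and yt h :: "'k poly"
  assumes "\<phi> \<in> J n"
    and "\<phi> = jonq a b c P"
    and "degree P = n"
    and "b \<noteq> 1 \<or> (b, c) = (1, 0)"
    and "P = (\<Sum>i\<le>n. smult (\<alpha> i) (ytilde b c ^ i))"
    and "xt = xtilde a b c n \<alpha>"
    and "yt = ytilde b c"
    and "h = h1 a b c n \<alpha>"
  shows
    "(root_of_unity a \<and> root_of_unity b \<and> h = 0 \<longrightarrow> finite_order \<phi>)
   \<and> (root_of_unity a \<and> root_of_unity b \<and> h \<noteq> 0 \<longrightarrow>
        Supp \<phi> = UNIV
      \<and> (\<exists>U \<subseteq> unions_of y_lines.
           generates_lattice \<phi> (U \<union> torsion_orbits_on \<phi> (zero_locus {[:h:]})))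
      \<and> (\<forall>p. torsion_point \<phi> p \<longleftrightarrow> p \<in> zero_locus {[:h:]}))
   \<and> (\<not> root_of_unity a \<and> root_of_unity b \<longrightarrow>
        Supp \<phi> = UNIV
      \<and> (\<exists>U \<subseteq> unions_of y_lines.
           generates_lattice \<phi> ({zero_locus {xt}} \<union> U \<union> torsion_orbits_on \<phi> (zero_locus {xt})))
      \<and> (\<forall>p. torsion_point \<phi> p \<longleftrightarrow> p \<in> zero_locus {xt}))
   \<and> (root_of_unity a \<and> \<not> root_of_unity b \<longrightarrow>
        equivariant \<phi> xt
      \<and> (h = 0 \<longrightarrow> Supp \<phi> = UNIV)
      \<and> (\<exists>U \<subseteq> unions_of (fibers xt).
           generates_lattice \<phi> (U \<union> {zero_locus {[:yt:]}} \<union> torsion_orbits_on \<phi> (zero_locus {[:yt:]})))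
      \<and> (h = 0 \<longrightarrow> (\<forall>p. torsion_point \<phi> p \<longleftrightarrow> p \<in> zero_locus {[:yt:]})))"
proof -
  define d where "d = (if b = 1 then 0 else c / (1 - b))"
  define q where "q = (\<Sum>i | i \<le> n \<and> a \<noteq> b ^ i. smult (\<alpha> i / (b ^ i - a)) (ytilde b c ^ i))"
  interpret straightened_jonquieres \<phi> a b d q h
    unfolding assms(2,8) using assms(1,2,4,5) q_def d_def
    by (intro straightened_jonquieres_jonq) auto
  have xt: "xt = [:- q, 1:]" by (simp add: assms(6) xtilde_def q_def)
  have yt: "yt = [:- d, 1:]" by (simp add: assms(7) ytilde_def d_def)
  show ?thesis
    unfolding xt yt
    using finite_order_if roots_of_unity_case b_root_of_unity_case X_equivariant
      a_root_of_unity_case_h_zero a_root_of_unity_case_h_nonzero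
    by (cases "h = 0") (simp_all del: split_paired_All)
qed

end
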